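(* Let $B$ be a unital C*-algebra, let $A \subset B$ be a C*-subalgebra containing the unit of $B$, let $E \colon B \to A$ be a faithful conditional expectation with index-finite type, and let $\big( (v_k, v_k^* ) \big)_{1 \leq k \leq n}$ be a quasi-basis for $E$. Then $$\mathrm{tsr}(B) \leq \mathrm{tsr}(A) + n - 1.$$
   Context: For a unital C*-algebra $A$, the topological stable rank $\mathrm{tsr}(A)$ is the least integer $n \ge 1$ such that the set $\mathrm{Lg}_n(A)$ of $n$-tuples $(a_1,\dots,a_n) \in A^n$ which generate $A$ as a left ideal is dense in $A^n$ ($\infty$ if there is no such $n$). For an inclusion $1 \in A \subset B$ of unital C*-algebras with common unit, a conditional expectation $E \colon B \to A$ is a positive $A$-bimodule map of norm one (with $E(a)=a$ for $a\in A$). For faithful $E$, a quasi-basis for $E$ is a finite family $\big((u_1,u_1^* ),\dots,(u_n,u_n^* )\big)$ of elements of $B \times B$ such that $b = \sum_{j=1}^n u_j E(u_j^* b) = \sum_{j=1}^n E(b u_j) u_j^*$ for all $b \in B$. $E$ has index-finite type if it has a quasi-basis. *)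

theory Defs
  imports "HOL-Analysis.Analysis" "HOL-Library.Extended_Nat"
begin

text \<open>
  Nontrivial unital C*-algebras. Completeness comes from \<open>banach\<close>; submultiplicativity of the norm and
  \<open>norm 1 = 1\<close> come from \<open>real_normed_algebra_1\<close>. The axiom \<open>scaleC_of_real\<close> ties the complex
  scalar multiplication to the real one (and in particular gives \<open>scaleC 1 x = x\<close>).
\<close>
class cstar_algebra = real_normed_algebra_1 + banach +
  fixes scaleC :: "complex \<Rightarrow> 'a \<Rightarrow> 'a"
    and adj :: "'a \<Rightarrow> 'a"
  assumes scaleC_add_right: "scaleC c (x + y) = scaleC c x + scaleC c y"
    and scaleC_add_left: "scaleC (c + d) x = scaleC c x + scaleC d x"
    and scaleC_scaleC: "scaleC c (scaleC d x) = scaleC (c * d) x"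
    and scaleC_of_real: "scaleC (complex_of_real r) x = scaleR r x"
    and norm_scaleC: "norm (scaleC c x) = cmod c * norm x"
    and mult_scaleC_left: "scaleC c x * y = scaleC c (x * y)"
    and mult_scaleC_right: "x * scaleC c y = scaleC c (x * y)"
    and adj_add: "adj (x + y) = adj x + adj y"
    and adj_scaleC: "adj (scaleC c x) = scaleC (cnj c) (adj x)"
    and adj_mult: "adj (x * y) = adj y * adj x"
    and adj_adj: "adj (adj x) = x"
    and norm_adj_mult_self: "norm (adj x * x) = (norm x)\<^sup>2"

text \<open>
  Below, \<open>A\<close> always ranges over C*-subalgebras of the ambient algebra; the ambient algebra itself
  is \<open>UNIV\<close>. All notions are relative to \<open>A\<close>, so they only depend on \<open>A\<close> as a C*-algebra.
\<close>
definition cstar_subalgebra :: "'a::cstar_algebra set \<Rightarrow> bool" where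
  "cstar_subalgebra A \<longleftrightarrow>
     closed A \<and> 0 \<in> A \<and>
     (\<forall>x\<in>A. \<forall>y\<in>A. x + y \<in> A) \<and>
     (\<forall>c. \<forall>x\<in>A. scaleC c x \<in> A) \<and>
     (\<forall>x\<in>A. \<forall>y\<in>A. x * y \<in> A) \<and>
     (\<forall>x\<in>A. adj x \<in> A)"

definition positive_in :: "'a::cstar_algebra set \<Rightarrow> 'a \<Rightarrow> bool" where
  "positive_in A x \<longleftrightarrow> (\<exists>y\<in>A. x = adj y * y)"

text \<open>
  Left ideals of a unital \<open>A\<close>. Closure under complex scalars and negation is automatic, because
  \<open>scaleC c x = scaleC c 1 * x\<close>.
\<close>
definition left_ideal_in :: "'a::cstar_algebra set \<Rightarrow> 'a set \<Rightarrow> bool" where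
  "left_ideal_in A I \<longleftrightarrow>
     I \<subseteq> A \<and> 0 \<in> I \<and>
     (\<forall>x\<in>I. \<forall>y\<in>I. x + y \<in> I) \<and>
     (\<forall>a\<in>A. \<forall>x\<in>I. a * x \<in> I)"

text \<open>Tuples in \<open>A\<^sup>n\<close> are extensional functions on \<open>{1..n}\<close>, as required by \<open>product_topology\<close>.\<close>
definition Lg :: "nat \<Rightarrow> 'a::cstar_algebra set \<Rightarrow> (nat \<Rightarrow> 'a) set" where
  "Lg n A = {a \<in> {1..n} \<rightarrow>\<^sub>E A. left_ideal_in A hull (a ` {1..n}) = A}"

definition Lg_dense :: "nat \<Rightarrow> 'a::cstar_algebra set \<Rightarrow> bool" where
  "Lg_dense n A \<longleftrightarrow>
     (product_topology (\<lambda>_. top_of_set A) {1..n}) closure_of (Lg n A) = ({1..n} \<rightarrow>\<^sub>E A)"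

text \<open>The infimum of the empty set in \<^typ>\<open>enat\<close> is \<open>\<infinity>\<close>.\<close>
definition tsr :: "'a::cstar_algebra set \<Rightarrow> enat" where
  "tsr A = Inf {enat n | n. 1 \<le> n \<and> Lg_dense n A}"

text \<open>
  \<open>bounded_linear\<close> and homogeneity for \<open>scaleC\<close> give complex linearity; boundedness
  also makes \<open>onorm E\<close> a genuine supremum.
\<close>
definition conditional_expectation :: "'b::cstar_algebra set \<Rightarrow> ('b \<Rightarrow> 'b) \<Rightarrow> bool" where
  "conditional_expectation A E \<longleftrightarrow>
     range E \<subseteq> A \<and>
     bounded_linear E \<and> (\<forall>c b. E (scaleC c b) = scaleC c (E b)) \<and>
     onorm E = 1 \<and>
     (\<forall>b. positive_in UNIV b \<longrightarrow> positive_in A (E b)) \<and>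
     (\<forall>a\<in>A. \<forall>b. E (a * b) = a * E b \<and> E (b * a) = E b * a) \<and>
     (\<forall>a\<in>A. E a = a)"

definition faithful :: "('b::cstar_algebra \<Rightarrow> 'b) \<Rightarrow> bool" where
  "faithful E \<longleftrightarrow> (\<forall>b. positive_in UNIV b \<longrightarrow> E b = 0 \<longrightarrow> b = 0)"

text \<open>The family \<open>((u\<^sub>j, u\<^sub>j\<^sup>*))\<close> for \<open>1 \<le> j \<le> n\<close> is encoded by its first components.\<close>
definition quasi_basis :: "('b::cstar_algebra \<Rightarrow> 'b) \<Rightarrow> nat \<Rightarrow> (nat \<Rightarrow> 'b) \<Rightarrow> bool" where
  "quasi_basis E n u \<longleftrightarrow>
     (\<forall>b. b = (\<Sum>j=1..n. u j * E (adj (u j) * b)) \<and>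
          b = (\<Sum>j=1..n. E (b * u j) * adj (u j)))"

definition index_finite_type :: "('b::cstar_algebra \<Rightarrow> 'b) \<Rightarrow> bool" where
  "index_finite_type E \<longleftrightarrow> (\<exists>n u. quasi_basis E n u)"

end

theory Submission
  imports Defs
begin

text \<open>
  The left \<open>A\<close>-module \<open>B\<close> is generated by \<open>v\<^sub>1\<^sup>*, \<dots>, v\<^sub>n\<^sup>*\<close>, since \<open>b = \<Sum>\<^sub>j E(b v\<^sub>j) v\<^sub>j\<^sup>*\<close>. If
  \<open>Lg\<^sub>k(A)\<close> is dense and a left \<open>A\<close>-module is generated by \<open>n\<close> elements, then
  every family of \<open>k + n - 1\<close> of its elements can be perturbed so that its \<open>A\<close>-span contains the
  generators: perturb the coefficients of one generator \<open>z\<close> so that the first \<open>k\<close> of them generate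
  \<open>A\<close>, use a row operation to make the coefficient in the last family member equal to 1, clear \<open>z\<close>
  from the other \<open>k + n - 2\<close> members, and induct on \<open>n\<close>. In \<open>B\<close>, a family whose \<open>A\<close>-span contains
  all \<open>v\<^sub>j\<^sup>*\<close> generates the unit \<open>1 = \<Sum>\<^sub>j E(v\<^sub>j) v\<^sub>j\<^sup>*\<close>.
\<close>

section \<open>Left spans over a unital subring\<close>

definition lspan :: "'a::ring_1 set \<Rightarrow> ('i \<Rightarrow> 'a) \<Rightarrow> 'i set \<Rightarrow> 'a set" where
  "lspan A w I = {\<Sum>i\<in>I. a i * w i | a. a \<in> I \<rightarrow> A}"

locale unital_subring =
  fixes A :: "'a::ring_1 set"
  assumes one_closed: "1 \<in> A"
    and diff_closed: "x \<in> A \<Longrightarrow> y \<in> A \<Longrightarrow> x - y \<in> A"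
    and mult_closed: "x \<in> A \<Longrightarrow> y \<in> A \<Longrightarrow> x * y \<in> A"
begin

lemma zero_closed: "0 \<in> A"
  using diff_closed[OF one_closed one_closed] by simp

lemma uminus_closed: "x \<in> A \<Longrightarrow> - x \<in> A"
  using diff_closed[OF zero_closed, of x] by simp

lemma add_closed: "x \<in> A \<Longrightarrow> y \<in> A \<Longrightarrow> x + y \<in> A"
  using diff_closed[of x "- y"] uminus_closed by simp

lemma sum_closed: "(\<And>i. i \<in> I \<Longrightarrow> f i \<in> A) \<Longrightarrow> sum f I \<in> A"
  by (induction I rule: infinite_finite_induct) (auto intro: zero_closed add_closed)

lemma lspanI: "a \<in> I \<rightarrow> A \<Longrightarrow> (\<Sum>i\<in>I. a i * w i) \<in> lspan A w I"
  by (auto simp: lspan_def)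

lemma lspanE:
  assumes "x \<in> lspan A w I"
  obtains a where "a \<in> I \<rightarrow> A" "x = (\<Sum>i\<in>I. a i * w i)"
  using assms by (auto simp: lspan_def)

lemma lspan_zero: "0 \<in> lspan A w I"
  using lspanI[of "\<lambda>_. 0" I w] zero_closed by simp

lemma lspan_add:
  assumes "x \<in> lspan A w I" "y \<in> lspan A w I"
  shows "x + y \<in> lspan A w I"
proof -
  obtain a where a: "a \<in> I \<rightarrow> A" "x = (\<Sum>i\<in>I. a i * w i)" using assms(1) by (rule lspanE)
  obtain b where b: "b \<in> I \<rightarrow> A" "y = (\<Sum>i\<in>I. b i * w i)" using assms(2) by (rule lspanE)
  have "(\<Sum>i\<in>I. (a i + b i) * w i) \<in> lspan A w I"
    using a b add_closed by (intro lspanI) auto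
  then show ?thesis by (simp add: a b distrib_right sum.distrib)
qed

lemma lspan_mult:
  assumes "c \<in> A" "x \<in> lspan A w I"
  shows "c * x \<in> lspan A w I"
proof -
  obtain a where a: "a \<in> I \<rightarrow> A" "x = (\<Sum>i\<in>I. a i * w i)" using assms(2) by (rule lspanE)
  have "(\<Sum>i\<in>I. (c * a i) * w i) \<in> lspan A w I"
    using a assms mult_closed by (intro lspanI) auto
  then show ?thesis by (simp add: a sum_distrib_left mult.assoc)
qed

lemma lspan_diff:
  assumes "x \<in> lspan A w I" "y \<in> lspan A w I"
  shows "x - y \<in> lspan A w I"
  using lspan_add[OF assms(1) lspan_mult[OF uminus_closed[OF one_closed] assms(2)]] by simp

lemma lspan_lincomb:
  assumes "\<And>i. i \<in> J \<Longrightarrow> a i \<in> A" "\<And>i. i \<in> J \<Longrightarrow> x i \<in> lspan A w I"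
  shows "(\<Sum>i\<in>J. a i * x i) \<in> lspan A w I"
  using assms
  by (induction J rule: infinite_finite_induct) (auto simp: lspan_zero intro: lspan_add lspan_mult)

lemma lspan_base:
  assumes "finite I" "i \<in> I"
  shows "w i \<in> lspan A w I"
proof -
  have "(\<Sum>j\<in>I. (if j = i then 1 else 0) * w j) \<in> lspan A w I"
    using one_closed zero_closed by (intro lspanI) auto
  also have "(\<Sum>j\<in>I. (if j = i then 1 else 0) * w j) = (\<Sum>j\<in>I. if j = i then w j else 0)"
    by (rule sum.cong) auto
  also have "\<dots> = w i" using assms by simp
  finally show ?thesis .
qed

lemma lspan_subset:
  assumes "\<And>j. j \<in> J \<Longrightarrow> u j \<in> lspan A w I"
  shows "lspan A u J \<subseteq> lspan A w I"
  using assms by (auto elim!: lspanE intro!: lspan_lincomb)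

text \<open>Splitting off the last generator drives the later induction on the number of
  generators.\<close>

lemma lspan_SucE:
  assumes "x \<in> lspan A w {1..Suc n}"
  obtains a r where "a \<in> A" "r \<in> lspan A w {1..n}" "x = a * w (Suc n) + r"
proof -
  obtain a where a: "a \<in> {1..Suc n} \<rightarrow> A" "x = (\<Sum>i=1..Suc n. a i * w i)"
    using assms by (rule lspanE)
  show ?thesis
  proof
    show "a (Suc n) \<in> A" using a by auto
    show "(\<Sum>i=1..n. a i * w i) \<in> lspan A w {1..n}" using a by (intro lspanI) auto
    show "x = a (Suc n) * w (Suc n) + (\<Sum>i=1..n. a i * w i)" using a by simp
  qed
qed

end

section \<open>Perturbing a family until it spans the generators\<close>

text \<open>With \<open>Suc n\<close> generators, the family size k + (n + 1) - 1 becomes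
  \<open>k + n\<close>, free of truncated subtraction. The assumption \<open>dense\<close> is
  density of \<open>Lg k A\<close>, where generating \<open>A\<close> is expressed by writing 1 as a
  left combination.\<close>

lemma perturb_to_spanning_family:
  fixes A :: "'a::real_normed_algebra_1 set"
  assumes "unital_subring A" and "1 \<le> k"
    and dense: "\<And>x e. x \<in> {1..k} \<rightarrow> A \<Longrightarrow> e > 0 \<Longrightarrow>
      \<exists>y\<in>{1..k} \<rightarrow> A. 1 \<in> lspan A y {1..k} \<and> (\<forall>i\<in>{1..k}. norm (y i - x i) < e)"
    and "b \<in> {1..k + n} \<rightarrow> lspan A w {1..Suc n}" and "0 < e"
  shows "\<exists>c. (\<forall>i\<in>{1..k + n}. norm (c i - b i) < e) \<and>
           (\<forall>j\<in>{1..Suc n}. w j \<in> lspan A c {1..k + n})"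
proof -
  interpret unital_subring A by fact
  \<comment> \<open>Only the first \<open>k\<close> coefficients of the generator \<open>z\<close>
    are moved; \<open>s\<close> certifies that the new ones generate \<open>A\<close>.\<close>
  have perturb: "\<exists>p s. p \<in> {1..m} \<rightarrow> A \<and> s \<in> {1..k} \<rightarrow> A \<and> (\<Sum>i=1..k. s i * p i) = 1 \<and>
      (\<forall>i\<in>{1..m}. norm (p i * z - x i * z) < e)"
    if x: "x \<in> {1..m} \<rightarrow> A" and "k \<le> m" "0 < e" for x :: "nat \<Rightarrow> 'a" and m z and e :: real
  proof -
    \<comment> \<open>Right multiplication by \<open>z\<close> costs a factor \<open>norm z\<close>;
      the added 1 also covers z = 0.\<close>
    let ?d = "e / (norm z + 1)"
    have z1: "norm z + 1 > 0" by (smt (verit) norm_ge_zero)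
    then have "?d > 0" using \<open>0 < e\<close> by simp
    moreover have "x \<in> {1..k} \<rightarrow> A" using x \<open>k \<le> m\<close> by auto
    ultimately obtain y where y: "y \<in> {1..k} \<rightarrow> A" "1 \<in> lspan A y {1..k}"
        "\<And>i. i \<in> {1..k} \<Longrightarrow> norm (y i - x i) < ?d"
      using dense by meson
    obtain s where s: "s \<in> {1..k} \<rightarrow> A" "1 = (\<Sum>i=1..k. s i * y i)"
      using y(2) by (rule lspanE)
    define p where "p i = (if i \<in> {1..k} then y i else x i)" for i
    have "norm (p i * z - x i * z) < e" if "i \<in> {1..m}" for i
    proof (cases "i \<in> {1..k}")
      case True
      have "norm (p i * z - x i * z) \<le> norm (y i - x i) * norm z"
        using True by (simp add: p_def left_diff_distrib[symmetric] norm_mult_ineq)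
      also have "\<dots> \<le> ?d * norm z"
        using y(3)[OF True] by (intro mult_right_mono) auto
      also have "\<dots> < e"
        using z1 \<open>0 < e\<close> by (simp add: field_simps)
      finally show ?thesis .
    qed (use \<open>0 < e\<close> in \<open>auto simp: p_def\<close>)
    moreover have "(\<Sum>i=1..k. s i * p i) = 1" using s by (simp add: p_def)
    moreover have "p \<in> {1..m} \<rightarrow> A" using x y(1) by (simp add: p_def Pi_iff del: atLeastAtMost_iff)
    ultimately show ?thesis using s(1) by blast
  qed
  show ?thesis
    using assms(4,5)
  proof (induction n arbitrary: b e)
    case 0
    have "\<forall>i\<in>{1..k}. \<exists>a\<in>A. b i = a * w 1"
      using 0(1) by (auto simp: lspan_def Pi_iff)
    then obtain x where x: "\<forall>i\<in>{1..k}. x i \<in> A \<and> b i = x i * w 1"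
      by metis
    have "x \<in> {1..k} \<rightarrow> A" using x by auto
    from perturb[OF this order_refl \<open>0 < e\<close>, of "w 1"] obtain p s where ps: "p \<in> {1..k} \<rightarrow> A" "s \<in> {1..k} \<rightarrow> A"
        "(\<Sum>i=1..k. s i * p i) = 1" "\<forall>i\<in>{1..k}. norm (p i * w 1 - x i * w 1) < e"
      by auto
    \<comment> \<open>Multiplying the relation \<open>(\<Sum>i=1..k. s i * p i) = 1\<close> by the
      only generator recovers it from the perturbed members.\<close>
    have "(\<Sum>i=1..k. s i * (p i * w 1)) \<in> lspan A (\<lambda>i. p i * w 1) {1..k}"
      using ps by (intro lspanI) auto
    moreover have "(\<Sum>i=1..k. s i * (p i * w 1)) = w 1"
      using ps(3) by (simp add: mult.assoc[symmetric] sum_distrib_right[symmetric])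
    ultimately show ?case
      using ps x by (intro exI[of _ "\<lambda>i. p i * w 1"]) auto
  next
    case (Suc n)
    \<comment> \<open>The last index \<open>m\<close> exceeds \<open>k\<close>, so adding multiples
      of the first \<open>k\<close> members to member \<open>m\<close> is an invertible row
      operation.\<close>
    define m where "m = Suc (k + n)"
    define z where "z = w (Suc (Suc n))"
    have m: "k + Suc n = m" "k \<le> m" by (auto simp: m_def)
    have "\<forall>i\<in>{1..m}. \<exists>a r. a \<in> A \<and> r \<in> lspan A w {1..Suc n} \<and> b i = a * z + r"
      using Suc.prems(1) unfolding m z_def by (metis lspan_SucE PiE)
    then obtain x r where xr: "\<And>i. i \<in> {1..m} \<Longrightarrow> x i \<in> A"
        "\<And>i. i \<in> {1..m} \<Longrightarrow> r i \<in> lspan A w {1..Suc n}" "\<And>i. i \<in> {1..m} \<Longrightarrow> b i = x i * z + r i"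
      by metis
    have "x \<in> {1..m} \<rightarrow> A" "e / 2 > 0" using xr Suc.prems by auto
    from perturb[OF this(1) m(2) this(2), of z] obtain p s
      where "p \<in> {1..m} \<rightarrow> A" "s \<in> {1..k} \<rightarrow> A" and sp: "(\<Sum>i=1..k. s i * p i) = 1"
      and near: "\<And>i. i \<in> {1..m} \<Longrightarrow> norm (p i * z - x i * z) < e / 2"
      by blast
    then have p: "\<And>i. i \<in> {1..m} \<Longrightarrow> p i \<in> A" and s: "\<And>i. i \<in> {1..k} \<Longrightarrow> s i \<in> A"
      by blast+
    have mm: "m \<in> {1..m}" by (auto simp: m_def)
    \<comment> \<open>With this choice the coefficient of \<open>z\<close> in \<open>g\<close> below
      is p_m + (1 - p_m) * 1 = 1, because the products s_i p_i sum to 1.\<close>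
    define q where "q = 1 - p m"
    have q: "q \<in> A" using p[OF mm] one_closed diff_closed by (simp add: q_def)
    define b' where "b' i = p i * z + r i" for i
    define t where "t = r m + q * (\<Sum>i=1..k. s i * r i)"
    define g where "g = b' m + q * (\<Sum>i=1..k. s i * b' i)"
    have t: "t \<in> lspan A w {1..Suc n}"
      unfolding t_def using xr(2) s q m mm by (intro lspan_add lspan_mult lspan_lincomb) auto
    have "(\<Sum>i=1..k. s i * b' i) = (\<Sum>i=1..k. s i * p i) * z + (\<Sum>i=1..k. s i * r i)"
      by (simp add: b'_def distrib_left sum.distrib sum_distrib_right mult.assoc)
    then have "g = p m * z + r m + q * (z + (\<Sum>i=1..k. s i * r i))"
      by (simp only: g_def sp mult_1_left b'_def[of m])
    then have g: "g = z + t"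
      by (simp add: t_def q_def distrib_left left_diff_distrib)
    \<comment> \<open>Subtracting \<open>p i * g\<close> from \<open>b' i\<close> cancels
      \<open>z\<close> and leaves a combination of the first n + 1 generators, to which the
      induction hypothesis applies.\<close>
    define c where "c i = r i - p i * t" for i
    have c_eq: "c i = b' i - p i * g" for i
      by (simp add: c_def b'_def g distrib_left)
    have c: "c \<in> {1..k + n} \<rightarrow> lspan A w {1..Suc n}"
      unfolding c_def using xr(2) p t by (auto intro!: lspan_diff lspan_mult simp: m_def)
    \<comment> \<open>Undoing the row operation moves the last member by at most
      \<open>K * d\<close>. The choice of \<open>d\<close> keeps both \<open>d\<close> and
      \<open>K * d\<close> within e/2; the other half of \<open>e\<close> pays for replacing
      \<open>x\<close> by \<open>p\<close>.\<close>
    define K where "K = norm q * (\<Sum>i=1..k. norm (s i))"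
    have K: "0 \<le> K" by (simp add: K_def sum_nonneg)
    define d where "d = e / 2 / (K + 1)"
    have d: "0 < d" "d \<le> e / 2" "K * d \<le> e / 2"
      using K \<open>0 < e\<close> by (auto simp: d_def field_simps mult_nonneg_nonneg add_pos_nonneg)
    obtain c' where c': "\<And>i. i \<in> {1..k + n} \<Longrightarrow> norm (c' i - c i) < d"
        "\<And>j. j \<in> {1..Suc n} \<Longrightarrow> w j \<in> lspan A c' {1..k + n}"
      using Suc.IH[OF c d(1)] by blast
    \<comment> \<open>The row operations are undone in reverse order with \<open>g\<close> left
      unperturbed: the last member is set so that adding
      \<open>q * (\<Sum>i=1..k. s i * h i)\<close> gives back exactly \<open>g\<close>.\<close>
    define h where "h i = c' i + p i * g" for i
    define f where "f i = (if i = m then g - q * (\<Sum>i=1..k. s i * h i) else h i)" for i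
    have f: "f i = h i" if "i \<in> {1..k + n}" for i
      using that by (auto simp: f_def m_def)
    have h_b': "norm (h i - b' i) < d" if "i \<in> {1..k + n}" for i
      using c'(1)[OF that] by (simp add: h_def c_eq algebra_simps)
    have f_b': "norm (f i - b' i) \<le> e / 2" if "i \<in> {1..m}" for i
    proof (cases "i = m")
      case True
      have "f i - b' i = - (q * (\<Sum>i=1..k. s i * (h i - b' i)))"
        using True by (simp add: f_def g_def right_diff_distrib sum_subtractf)
      then have "norm (f i - b' i) \<le> norm q * norm (\<Sum>i=1..k. s i * (h i - b' i))"
        by (simp add: norm_mult_ineq)
      also have "norm (\<Sum>i=1..k. s i * (h i - b' i)) \<le> (\<Sum>i=1..k. norm (s i) * d)"
      proof (rule sum_norm_le)
        fix i assume "i \<in> {1..k}"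
        then have "norm (h i - b' i) \<le> d" using h_b'[of i] by auto
        then show "norm (s i * (h i - b' i)) \<le> norm (s i) * d"
          by (meson norm_mult_ineq order_trans mult_left_mono norm_ge_zero)
      qed
      then have "norm q * norm (\<Sum>i=1..k. s i * (h i - b' i)) \<le> K * d"
        unfolding K_def by (simp add: mult_left_mono mult.assoc sum_distrib_right)
      finally show ?thesis using d by simp
    next
      case False
      then have "i \<in> {1..k + n}" using that by (auto simp: m_def)
      then show ?thesis using h_b' d f by fastforce
    qed
    have close: "norm (f i - b i) < e" if "i \<in> {1..m}" for i
    proof -
      have "b' i - b i = p i * z - x i * z" using xr(3)[OF that] by (simp add: b'_def)
      then have "norm (b' i - b i) < e / 2" using near[OF that] by simp
      with f_b'[OF that] show ?thesis
        using norm_triangle_ineq[of "f i - b' i" "b' i - b i"] by simp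
    qed
    \<comment> \<open>Order of recovery inside the span of \<open>f\<close>: first \<open>g\<close>,
      then each \<open>c' i = h i - p i * g\<close>, hence the first n + 1 generators, hence
      \<open>t\<close>, and finally \<open>z = g - t\<close>.\<close>
    let ?S = "lspan A f {1..m}"
    have f_in: "f i \<in> ?S" if "i \<in> {1..m}" for i
      using that by (intro lspan_base) auto
    then have h_in: "h i \<in> ?S" if "i \<in> {1..k + n}" for i
      using that f by (metis atLeastAtMost_iff le_SucI m_def)
    have "f m + q * (\<Sum>i=1..k. s i * h i) \<in> ?S"
      using f_in h_in q s mm by (intro lspan_add lspan_mult lspan_lincomb) auto
    then have g_in: "g \<in> ?S" by (simp add: f_def)
    have "h i - p i * g \<in> ?S" if "i \<in> {1..k + n}" for i
      using that p g_in h_in by (intro lspan_diff lspan_mult) (auto simp: m_def)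
    then have "c' i \<in> ?S" if "i \<in> {1..k + n}" for i
      using that by (simp add: h_def)
    then have w_in: "w j \<in> ?S" if "j \<in> {1..Suc n}" for j
      using c'(2)[OF that] lspan_subset by blast
    then have "t \<in> ?S" using t lspan_subset by blast
    with g_in have "z \<in> ?S" using lspan_diff[of g f "{1..m}" t] g by simp
    with w_in have "w j \<in> ?S" if "j \<in> {1..Suc (Suc n)}" for j
      using that by (cases "j = Suc (Suc n)") (auto simp: z_def)
    with close show ?case unfolding m by blast
  qed
qed

section \<open>Density as approximation in norm\<close>

text \<open>In a finite product, boxes of relative balls of a common radius form a neighbourhood
  base, so lying in the closure means simultaneous approximation of all coordinates.\<close>

lemma Lg_dense_iff:
  "Lg_dense n A \<longleftrightarrow>
    (\<forall>x \<in> {1..n} \<rightarrow>\<^sub>E A. \<forall>e>0. \<exists>y\<in>Lg n A. \<forall>i\<in>{1..n}. norm (y i - x i) < e)"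
  (is "_ \<longleftrightarrow> ?R")
proof
  let ?X = "product_topology (\<lambda>_. top_of_set A) {1..n}"
  assume L: "Lg_dense n A"
  show ?R
  proof (intro ballI allI impI)
    fix x and e :: real assume x: "x \<in> {1..n} \<rightarrow>\<^sub>E A" and "e > 0"
    let ?U = "\<Pi>\<^sub>E i\<in>{1..n}. A \<inter> ball (x i) e"
    have "openin ?X ?U" by (simp add: openin_PiE_gen openin_open_Int)
    moreover have "x \<in> ?U" using x \<open>e > 0\<close> by (auto simp: PiE_iff)
    moreover have "x \<in> ?X closure_of Lg n A" using L x by (simp add: Lg_dense_def)
    ultimately obtain y where y: "y \<in> Lg n A" "y \<in> ?U" unfolding in_closure_of by blast
    have "norm (y i - x i) < e" if "i \<in> {1..n}" for i
      using PiE_mem[OF y(2) that] by (simp add: dist_norm norm_minus_commute)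
    with y(1) show "\<exists>y\<in>Lg n A. \<forall>i\<in>{1..n}. norm (y i - x i) < e"
      by blast
  qed
next
  let ?X = "product_topology (\<lambda>_. top_of_set A) {1..n}"
  assume R: ?R
  have "x \<in> ?X closure_of Lg n A" if x: "x \<in> {1..n} \<rightarrow>\<^sub>E A" for x
    unfolding in_closure_of
  proof (intro conjI allI impI)
    show "x \<in> topspace ?X" using x by simp
    fix T assume "x \<in> T \<and> openin ?X T"
    then have "\<exists>U. finite {i \<in> {1..n}. U i \<noteq> topspace (top_of_set A)} \<and>
        (\<forall>i\<in>{1..n}. openin (top_of_set A) (U i)) \<and> x \<in> Pi\<^sub>E {1..n} U \<and> Pi\<^sub>E {1..n} U \<subseteq> T"
      unfolding openin_product_topology_alt by (elim conjE) (erule bspec)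
    then obtain U where U: "\<forall>i\<in>{1..n}. openin (top_of_set A) (U i)"
        "x \<in> Pi\<^sub>E {1..n} U" "Pi\<^sub>E {1..n} U \<subseteq> T"
      by (elim exE conjE) (rule that; assumption)
    have "\<exists>e>0. ball (x i) e \<inter> A \<subseteq> U i" if "i \<in> {1..n}" for i
      using bspec[OF U(1) that] PiE_mem[OF U(2) that] unfolding openin_contains_ball by blast
    then have "\<forall>i\<in>{1..n}. \<exists>e>0. ball (x i) e \<inter> A \<subseteq> U i" by blast
    from bchoice[OF this] obtain e
      where e: "\<And>i. i \<in> {1..n} \<Longrightarrow> e i > 0 \<and> ball (x i) (e i) \<inter> A \<subseteq> U i"
      by blast
    \<comment> \<open>Finiteness makes the common radius positive; inserting 1 keeps the minimum
      meaningful for n = 0.\<close>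
    define d where "d = Min (insert 1 (e ` {1..n}))"
    have "d > 0" using e by (auto simp: d_def)
    have d_le: "d \<le> e i" if "i \<in> {1..n}" for i
      unfolding d_def using that by (intro Min_le) auto
    obtain y where y: "y \<in> Lg n A" "\<forall>i\<in>{1..n}. norm (y i - x i) < d" using bspec[OF R x] \<open>d > 0\<close> by blast
    have yU: "y i \<in> U i" if "i \<in> {1..n}" for i
    proof -
      have "y i \<in> A" using y(1) that by (auto simp: Lg_def)
      moreover have "y i \<in> ball (x i) (e i)"
        using bspec[OF y(2) that] d_le[OF that] by (simp add: dist_norm norm_minus_commute)
      ultimately show ?thesis using e[OF that] by blast
    qed
    have "y \<in> extensional {1..n}" using y(1) by (simp add: Lg_def PiE_def)
    with yU have "y \<in> Pi\<^sub>E {1..n} U" unfolding PiE_iff by blast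
    then have "y \<in> T" using U(3) by blast
    with y(1) show "\<exists>y. y \<in> Lg n A \<and> y \<in> T" by blast
  qed
  moreover have "?X closure_of Lg n A \<subseteq> {1..n} \<rightarrow>\<^sub>E A"
    using closure_of_subset_topspace[of ?X "Lg n A"] by simp
  ultimately show "Lg_dense n A" unfolding Lg_dense_def by blast
qed

section \<open>Application to C*-subalgebras and stable rank\<close>

lemma cstar_subalgebra_unital_subring:
  fixes A :: "'a::cstar_algebra set"
  assumes "cstar_subalgebra A" and "1 \<in> A"
  shows "unital_subring A"
proof
  fix x y assume "x \<in> A" "y \<in> A"
  moreover have "scaleC (-1) y = - y"
    using scaleC_of_real[of "-1" y] by simp
  ultimately show "x - y \<in> A" "x * y \<in> A"
    using assms unfolding cstar_subalgebra_def
    by (metis add_uminus_conv_diff, blast)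
qed fact

text \<open>The span of the tuple is itself a left ideal of \<open>A\<close> containing the tuple,
  so it contains the generated left ideal, which is all of \<open>A\<close>.\<close>

lemma Lg_one_in_lspan:
  assumes "unital_subring A" and "x \<in> Lg n A"
  shows "1 \<in> lspan A x {1..n}"
proof -
  interpret unital_subring A by fact
  have xA: "x i \<in> A" if "i \<in> {1..n}" for i using assms(2) that by (auto simp: Lg_def)
  have "lspan A x {1..n} \<subseteq> A"
  proof
    fix y assume "y \<in> lspan A x {1..n}"
    then obtain a where "a \<in> {1..n} \<rightarrow> A" "y = (\<Sum>i=1..n. a i * x i)" by (rule lspanE)
    then show "y \<in> A" using xA by (auto intro!: sum_closed mult_closed)
  qed
  then have "left_ideal_in A (lspan A x {1..n})"
    unfolding left_ideal_in_def using lspan_zero lspan_add lspan_mult by blast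
  then have "left_ideal_in A hull (x ` {1..n}) \<subseteq> lspan A x {1..n}"
    by (intro hull_minimal) (auto intro: lspan_base)
  then show ?thesis using assms(2) one_closed by (auto simp: Lg_def)
qed

theorem theorem2p2:
  fixes A :: "'b::cstar_algebra set"
    and E :: "'b \<Rightarrow> 'b"
    and n :: nat
    and v :: "nat \<Rightarrow> 'b"
  assumes "cstar_subalgebra A" and "1 \<in> A"
    and "conditional_expectation A E"
    and "faithful E"
    and "index_finite_type E"
    and "quasi_basis E n v"
  shows "tsr (UNIV :: 'b set) \<le> tsr A + enat n - 1"
proof (cases "tsr A")
  case infinity
  then show ?thesis by (simp add: one_enat_def)
next
  case (enat k)
  interpret unital_subring A
    using assms(1,2) by (rule cstar_subalgebra_unital_subring)
  \<comment> \<open>A finite infimum forces \<open>?D\<close> to be nonempty, and by well-ordering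
    the infimum is attained: density holds for k = tsr(A) itself.\<close>
  let ?D = "{enat n | n. 1 \<le> n \<and> Lg_dense n A}"
  have "?D \<noteq> {}"
  proof
    assume "?D = {}"
    then have "tsr A = \<infinity>" unfolding tsr_def by (simp only: Inf_enat_def simp_thms if_True)
    with enat show False by simp
  qed
  then obtain d where "d \<in> ?D" by blast
  then have "tsr A \<in> ?D" unfolding tsr_def by (rule wellorder_InfI)
  with enat have k: "1 \<le> k" "Lg_dense k A" by auto
  have qb: "b = (\<Sum>j=1..n. E (b * v j) * adj (v j))" for b
    using assms(6) unfolding quasi_basis_def by blast
  \<comment> \<open>An empty quasi-basis would give 1 = 0. Hence n = l + 1, and subtracting 1 in the
    final bound is genuine.\<close>
  have "n \<noteq> 0"
  proof
    assume "n = 0"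
    then have "(\<Sum>j=1..n. E (1 * v j) * adj (v j)) = 0" by simp
    with qb[of 1] have "(1 :: 'b) = 0" by (rule trans)
    then show False by simp
  qed
  then obtain l where l: "n = Suc l" by (cases n) auto
  have E: "E b \<in> A" for b using assms(3) by (auto simp: conditional_expectation_def)
  define w where "w j = adj (v j)" for j
  have span: "b \<in> lspan A w {1..Suc l}" for b
    using lspanI[of "\<lambda>j. E (b * v j)" "{1..Suc l}" w] E qb[of b, symmetric] by (simp add: w_def l)
  have dense: "\<exists>y\<in>{1..k} \<rightarrow> A. 1 \<in> lspan A y {1..k} \<and> (\<forall>i\<in>{1..k}. norm (y i - x i) < e)"
    if x: "x \<in> {1..k} \<rightarrow> A" and "0 < e" for x and e :: real
  proof -
    \<comment> \<open>Tuples in \<open>Lg\<close> are extensional whereas the perturbation lemma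
      takes arbitrary functions; \<open>restrict\<close> mediates here and for \<open>c\<close>
      below.\<close>
    have "restrict x {1..k} \<in> {1..k} \<rightarrow>\<^sub>E A" using x by auto
    then obtain y where y: "y \<in> Lg k A" "\<forall>i\<in>{1..k}. norm (y i - restrict x {1..k} i) < e"
      using iffD1[OF Lg_dense_iff k(2)] \<open>0 < e\<close> by blast
    moreover have "y \<in> {1..k} \<rightarrow> A" using y(1) by (auto simp: Lg_def)
    ultimately show ?thesis using Lg_one_in_lspan[OF unital_subring_axioms y(1)] by auto
  qed
  have "Lg_dense (k + l) (UNIV :: 'b set)"
    unfolding Lg_dense_iff
  proof (intro ballI allI impI)
    fix b :: "nat \<Rightarrow> 'b" and e :: real assume "0 < e"
    have "b \<in> {1..k + l} \<rightarrow> lspan A w {1..Suc l}" using span by simp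
    from perturb_to_spanning_family[OF unital_subring_axioms k(1) dense this \<open>0 < e\<close>]
    obtain c where c: "\<And>i. i \<in> {1..k + l} \<Longrightarrow> norm (c i - b i) < e"
        "\<And>j. j \<in> {1..Suc l} \<Longrightarrow> w j \<in> lspan A c {1..k + l}"
      by blast
    have c1: "1 \<in> lspan A c {1..k + l}"
      by (rule subsetD[OF lspan_subset[OF c(2)] span])
    \<comment> \<open>The hull is the intersection of all left ideals containing the tuple, so each
      of these must be everything. Such an ideal absorbs the coefficients representing 1 and hence
      contains 1.\<close>
    have I: "I = UNIV" if I: "left_ideal_in UNIV I" "c ` {1..k + l} \<subseteq> I" for I
    proof -
      obtain a where a: "1 = (\<Sum>i=1..k + l. a i * c i)" using c1 by (rule lspanE)
      have add: "x + y \<in> I" if "x \<in> I" "y \<in> I" for x y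
        using I(1) that unfolding left_ideal_in_def by blast
      have ac: "a i * c i \<in> I" if "i \<in> {1..k + l}" for i
        using I that unfolding left_ideal_in_def by blast
      \<comment> \<open>Ideals are closed under binary sums, so the full sum is reached by induction
        over finite subsets of the index set.\<close>
      have "(\<Sum>i\<in>J. a i * c i) \<in> I" if "J \<subseteq> {1..k + l}" for J
        using finite_subset[OF that finite_atLeastAtMost] that
      proof (induction J rule: finite_induct)
        case empty
        then show ?case using I(1) by (simp add: left_ideal_in_def)
      qed (simp add: add ac)
      from this[OF order_refl] have "1 \<in> I" unfolding a .
      then show ?thesis using I(1) unfolding left_ideal_in_def by (metis UNIV_I UNIV_eq_I mult_1_right)
    qed
    have "restrict c {1..k + l} \<in> Lg (k + l) UNIV"
      unfolding Lg_def hull_def using I by auto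
    then show "\<exists>y\<in>Lg (k + l) UNIV. \<forall>i\<in>{1..k + l}. norm (y i - b i) < e"
      using c(1) by (intro bexI[of _ "restrict c {1..k + l}"]) auto
  qed
  then have "tsr (UNIV :: 'b set) \<le> enat (k + l)"
    unfolding tsr_def using k(1) by (intro Inf_lower) auto
  also have "enat (k + l) = tsr A + enat n - 1"
    by (simp add: enat l one_enat_def)
  finally show ?thesis .
qed

end
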